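(* Let $\mathcal{X}$ be a non-empty finite set and $N\geq1$ an integer. A set of gambles $\mathcal{R}\subseteq\mathcal{G}(\mathcal{X}^N)$, with count representation $\mathcal{S}:=\mathrm{Hy}^N(\mathcal{R})$, is coherent and exchangeable if and only if there is some subset $\mathcal{H}$ of $\mathcal{V}^N(\Sigma_{\mathcal{X}})$, Bernstein coherent at degree $N$, such that $$\mathcal{R}=(\mathrm{Mn}^N)^{-1}(\mathcal{H})\quad\text{or equivalently}\quad\mathcal{S}=(\mathrm{CoMn}^N)^{-1}(\mathcal{H}),$$ and in that case this $\mathcal{H}$ is uniquely determined by $$\mathcal{H}=\mathrm{Mn}^N(\mathcal{R})=\mathrm{CoMn}^N(\mathcal{S}).$$
   Context: A gamble on a non-empty set $\Omega$ is a bounded function $\Omega\to\mathbb{R}$; $\mathcal{G}(\Omega)$ is the linear space of all gambles on $\Omega$. Write $f\geq g$ for the pointwise ordering, and $f>g$ iff $f\geq g$ and $f\neq g$. A set $\mathcal{R}\subseteq\mathcal{G}(\Omega)$ is coherent if: (D1) $0\notin\mathcal{R}$; (D2) $f>0$ implies $f\in\mathcal{R}$; (D3) $f\in\mathcal{R}$ and $\lambda>0$ imply $\lambda f\in\mathcal{R}$; (D4) $f_1,f_2\in\mathcal{R}$ implies $f_1+f_2\in\mathcal{R}$. Let $\mathcal{P}_N$ be the set of permutations $\pi$ of $\{1,\dots,N\}$; put $\pi(x_1,\dots,x_N)=(x_{\pi(1)},\dots,x_{\pi(N)})$ and $\pi^tf=f\circ\pi$. A coherent set $\mathcal{R}\subseteq\mathcal{G}(\mathcal{X}^N)$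 is exchangeable if $h+(f-\pi^tf)\in\mathcal{R}$ for all $h\in\mathcal{R}$, $f\in\mathcal{G}(\mathcal{X}^N)$, $\pi\in\mathcal{P}_N$. $\mathcal{N}^N=\{m\in\mathbb{Z}_{\geq0}^{\mathcal{X}}:\sum_{z}m_z=N\}$. For $m\in\mathcal{N}^N$, $[m]$ is the set of $x\in\mathcal{X}^N$ in which each $z\in\mathcal{X}$ occurs exactly $m_z$ times, so $|[m]|=N!/\prod_zm_z!$. The linear map $\mathrm{Hy}^N:\mathcal{G}(\mathcal{X}^N)\to\mathcal{G}(\mathcal{N}^N)$ is given by $\mathrm{Hy}^N(f)(m)=\frac{1}{|[m]|}\sum_{y\in[m]}f(y)$, and $\mathrm{Hy}^N(\mathcal{R})=\{\mathrm{Hy}^N(f):f\in\mathcal{R}\}$. $\Sigma_{\mathcal{X}}=\{\theta\in\mathbb{R}^{\mathcal{X}}:\theta\geq0,\sum_x\theta_x=1\}$. For $m\in\mathcal{N}^N$ the Bernstein basis polynomial is $B_m(\theta)=|[m]|\prod_{z\in\mathcal{X}}\theta_z^{m_z}$ on $\Sigma_{\mathcal{X}}$ (with $0^0=1$). $\mathcal{V}^N(\Sigma_{\mathcal{X}})$ is the linear space of polynomial functions on $\Sigma_{\mathcal{X}}$ of degree at most $N$; $\{B_m:m\in\mathcal{N}^N\}$ is a basis of it, so every $p\in\mathcal{V}^N(\Sigma_{\mathcal{X}})$ has a unique expansion $p=\sum_{m\in\mathcal{N}^N}b_p^N(m)B_m$ with $b_p^N\in\mathcal{G}(\mathcal{N}^N)$.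 Define $\mathrm{CoMn}^N(g)=\sum_{m\in\mathcal{N}^N}g(m)B_m$ for $g\in\mathcal{G}(\mathcal{N}^N)$, and $\mathrm{Mn}^N=\mathrm{CoMn}^N\circ\mathrm{Hy}^N$ on $\mathcal{G}(\mathcal{X}^N)$. Superscripts $-1$ denote inverse images of sets. A set $\mathcal{H}\subseteq\mathcal{V}^N(\Sigma_{\mathcal{X}})$ is Bernstein coherent at degree $N$ if for all $p,p_1,p_2\in\mathcal{V}^N(\Sigma_{\mathcal{X}})$ and real $\lambda>0$: $0\notin\mathcal{H}$; $b_p^N>0$ implies $p\in\mathcal{H}$; $p\in\mathcal{H}$ implies $\lambda p\in\mathcal{H}$; $p_1,p_2\in\mathcal{H}$ implies $p_1+p_2\in\mathcal{H}$.
   Formalization: The equivalence of R=(Mn^N)^{-1}(H) with S=(CoMn^N)^{-1}(H) is stated for exchangeable R only; for arbitrary R it fails: the permutation-invariant gambles f with Hy^N(f)>0 have S=(CoMn^N)^{-1}(H), H={p: b_p^N>0}, but are not coherent when N≥2 and X has at least two elements. *)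

theory Defs
  imports "HOL-Analysis.Analysis" "HOL-Library.Function_Algebras"
begin

text \<open>
  A real function on a set \<open>\<Omega>\<close> is represented by the total function that extends it by
  \<open>0\<close> outside \<open>\<Omega>\<close>. Thus equality, sum, difference, zero and the pointwise ordering of such
  functions are those of the function type (the first four from \<open>Function_Algebras\<close>).
\<close>

definition gambles :: "'w set \<Rightarrow> ('w \<Rightarrow> real) set" where
  "gambles \<Omega> = {f. bounded (f ` \<Omega>) \<and> (\<forall>w. w \<notin> \<Omega> \<longrightarrow> f w = 0)}"

definition coherent :: "'w set \<Rightarrow> ('w \<Rightarrow> real) set \<Rightarrow> bool" where
  "coherent \<Omega> R \<longleftrightarrow>
     R \<subseteq> gambles \<Omega> \<and>
     0 \<notin> R \<and>
     (\<forall>f\<in>gambles \<Omega>. f \<ge> 0 \<and> f \<noteq> 0 \<longrightarrow> f \<in> R) \<and>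
     (\<forall>f\<in>R. \<forall>c::real. c > 0 \<longrightarrow> (\<lambda>w. c * f w) \<in> R) \<and>
     (\<forall>f\<in>R. \<forall>g\<in>R. f + g \<in> R)"

definition seqs :: "'a set \<Rightarrow> nat \<Rightarrow> (nat \<Rightarrow> 'a) set" where
  "seqs X N = {1..N} \<rightarrow>\<^sub>E X"

text \<open>
  For \<open>\<pi>\<close> permuting \<open>{1..N}\<close>, the permuted sequence is \<open>x \<circ> \<pi>\<close>; as \<open>\<pi>\<close> is the identity outside
  \<open>{1..N}\<close>, it lies in \<open>seqs X N\<close> iff \<open>x\<close> does.
\<close>

definition perm_lift :: "(nat \<Rightarrow> nat) \<Rightarrow> ((nat \<Rightarrow> 'a) \<Rightarrow> real) \<Rightarrow> (nat \<Rightarrow> 'a) \<Rightarrow> real" where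
  "perm_lift \<pi> f = (\<lambda>x. f (x \<circ> \<pi>))"

definition exchangeable :: "'a set \<Rightarrow> nat \<Rightarrow> ((nat \<Rightarrow> 'a) \<Rightarrow> real) set \<Rightarrow> bool" where
  "exchangeable X N R \<longleftrightarrow>
     (\<forall>h\<in>R. \<forall>f\<in>gambles (seqs X N). \<forall>\<pi>. \<pi> permutes {1..N} \<longrightarrow> h + (f - perm_lift \<pi> f) \<in> R)"

definition counts :: "'a set \<Rightarrow> nat \<Rightarrow> ('a \<Rightarrow> nat) set" where
  "counts X N = {m \<in> extensional X. (\<Sum>z\<in>X. m z) = N}"

definition count_atom :: "'a set \<Rightarrow> nat \<Rightarrow> ('a \<Rightarrow> nat) \<Rightarrow> (nat \<Rightarrow> 'a) set" where
  "count_atom X N m = {x \<in> seqs X N. \<forall>z\<in>X. card {k \<in> {1..N}. x k = z} = m z}"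

definition Hy :: "'a set \<Rightarrow> nat \<Rightarrow> ((nat \<Rightarrow> 'a) \<Rightarrow> real) \<Rightarrow> ('a \<Rightarrow> nat) \<Rightarrow> real" where
  "Hy X N f = (\<lambda>m. if m \<in> counts X N
     then (\<Sum>y\<in>count_atom X N m. f y) / real (card (count_atom X N m)) else 0)"

definition prob_simplex :: "'a set \<Rightarrow> ('a \<Rightarrow> real) set" where
  "prob_simplex X = {\<theta> \<in> extensional X. (\<forall>z\<in>X. \<theta> z \<ge> 0) \<and> (\<Sum>z\<in>X. \<theta> z) = 1}"

definition bernstein :: "'a set \<Rightarrow> nat \<Rightarrow> ('a \<Rightarrow> nat) \<Rightarrow> ('a \<Rightarrow> real) \<Rightarrow> real" where
  "bernstein X N m = (\<lambda>\<theta>. if \<theta> \<in> prob_simplex X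
     then real (card (count_atom X N m)) * (\<Prod>z\<in>X. \<theta> z ^ m z) else 0)"

definition poly_space :: "'a set \<Rightarrow> nat \<Rightarrow> (('a \<Rightarrow> real) \<Rightarrow> real) set" where
  "poly_space X N = {p. \<exists>c :: ('a \<Rightarrow> nat) \<Rightarrow> real.
     p = (\<lambda>\<theta>. if \<theta> \<in> prob_simplex X
       then (\<Sum>\<alpha> | \<alpha> \<in> extensional X \<and> (\<Sum>z\<in>X. \<alpha> z) \<le> N. c \<alpha> * (\<Prod>z\<in>X. \<theta> z ^ \<alpha> z)) else 0)}"

definition CoMn :: "'a set \<Rightarrow> nat \<Rightarrow> (('a \<Rightarrow> nat) \<Rightarrow> real) \<Rightarrow> ('a \<Rightarrow> real) \<Rightarrow> real" where
  "CoMn X N g = (\<lambda>\<theta>. \<Sum>m\<in>counts X N. g m * bernstein X N m \<theta>)"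

definition Mn :: "'a set \<Rightarrow> nat \<Rightarrow> ((nat \<Rightarrow> 'a) \<Rightarrow> real) \<Rightarrow> ('a \<Rightarrow> real) \<Rightarrow> real" where
  "Mn X N = CoMn X N \<circ> Hy X N"

text \<open>
  The description below is unique for finite nonempty \<open>X\<close> and \<open>p \<in> poly_space X N\<close>, since the
  Bernstein polynomials of degree \<open>N\<close> form a basis of \<open>poly_space X N\<close>.
\<close>

definition bernstein_coeffs :: "'a set \<Rightarrow> nat \<Rightarrow> (('a \<Rightarrow> real) \<Rightarrow> real) \<Rightarrow> ('a \<Rightarrow> nat) \<Rightarrow> real" where
  "bernstein_coeffs X N p =
     (THE b. b \<in> gambles (counts X N) \<and> p = (\<lambda>\<theta>. \<Sum>m\<in>counts X N. b m * bernstein X N m \<theta>))"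

definition bernstein_coherent :: "'a set \<Rightarrow> nat \<Rightarrow> (('a \<Rightarrow> real) \<Rightarrow> real) set \<Rightarrow> bool" where
  "bernstein_coherent X N H \<longleftrightarrow>
     H \<subseteq> poly_space X N \<and>
     0 \<notin> H \<and>
     (\<forall>p\<in>poly_space X N.
        bernstein_coeffs X N p \<ge> 0 \<and> bernstein_coeffs X N p \<noteq> 0 \<longrightarrow> p \<in> H) \<and>
     (\<forall>p\<in>H. \<forall>c::real. c > 0 \<longrightarrow> (\<lambda>\<theta>. c * p \<theta>) \<in> H) \<and>
     (\<forall>p\<in>H. \<forall>q\<in>H. p + q \<in> H)"

end

theory Submission
  imports Defs "HOL-Combinatorics.Permutations"
begin

subsection \<open>Sequences and counts\<close>

text \<open>\<open>Mn X N\<close> is a linear map from the gambles on sequences onto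
  \<open>poly_space X N\<close>, and its kernel is spanned by the differences
  \<open>f - perm_lift \<pi> f\<close>; the theorem follows from these two facts.

  The kernel: \<open>Hy\<close> averages over the count atoms, which are exactly the permutation
  orbits of sequences. So it annihilates the differences (\<open>Hy_perm_lift\<close>), and
  conversely a gamble whose atom sums all vanish is a sum of differences
  (\<open>exchangeable_add_kernel\<close>). The second factor \<open>CoMn\<close> is a linear
  isomorphism, because the Bernstein polynomials are a basis (\<open>CoMn_inj\<close>,
  \<open>CoMn_surj\<close>), and \<open>count_lift\<close> is a right inverse of \<open>Hy\<close>.
  Hence \<open>Mn\<close> is onto and has the same kernel as \<open>Hy\<close>.

  Exchangeability of \<open>R\<close> therefore means that \<open>R\<close> is a union of fibres of
  \<open>Mn\<close>, that is, the inverse image of its own image. Coherence passes in both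
  directions: the cone conditions by linearity; positivity because \<open>Hy\<close> preserves it
  (\<open>Hy_pos\<close>) and every positive gamble on counts has a positive lift; the exclusion of
  0 because a union of fibres that meets the kernel contains 0. Surjectivity makes \<open>H\<close>
  the image of its inverse image, which gives uniqueness.\<close>

lemma finite_seqs: "finite X \<Longrightarrow> finite (seqs X N)"
  by (simp add: seqs_def finite_PiE)

lemma finite_extensional_sum_le:
  assumes "finite X"
  shows "finite {\<alpha> \<in> extensional X. (\<Sum>z\<in>X. \<alpha> z) \<le> (N::nat)}"
proof (rule finite_subset)
  show "{\<alpha> \<in> extensional X. (\<Sum>z\<in>X. \<alpha> z) \<le> N} \<subseteq> X \<rightarrow>\<^sub>E {..N}"
  proof
    fix \<alpha> assume \<alpha>: "\<alpha> \<in> {\<alpha> \<in> extensional X. (\<Sum>z\<in>X. \<alpha> z) \<le> N}"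
    then have "\<alpha> z \<le> N" if "z \<in> X" for z
      using member_le_sum [OF that, of \<alpha>] assms by auto
    with \<alpha> show "\<alpha> \<in> X \<rightarrow>\<^sub>E {..N}"
      by (auto simp: PiE_iff)
  qed
  show "finite (X \<rightarrow>\<^sub>E {..N})"
    using assms by (simp add: finite_PiE)
qed

lemma finite_counts:
  assumes "finite X"
  shows "finite (counts X N)"
  by (rule finite_subset [OF _ finite_extensional_sum_le [OF assms, of N]]) (auto simp: counts_def)

lemma gambles_iff:
  assumes "finite \<Omega>"
  shows "f \<in> gambles \<Omega> \<longleftrightarrow> (\<forall>w. w \<notin> \<Omega> \<longrightarrow> f w = 0)"
  using assms by (auto simp: gambles_def finite_imp_bounded)

lemma gambles_add: "finite \<Omega> \<Longrightarrow> f \<in> gambles \<Omega> \<Longrightarrow> g \<in> gambles \<Omega> \<Longrightarrow> f + g \<in> gambles \<Omega>"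
  by (simp add: gambles_iff)

lemma gambles_scale: "finite \<Omega> \<Longrightarrow> f \<in> gambles \<Omega> \<Longrightarrow> (\<lambda>w. c * f w) \<in> gambles \<Omega>"
  by (simp add: gambles_iff)

text \<open>The complete invariant of the permutation action on sequences. Restricting it to
  \<open>X\<close> places it in \<open>extensional X\<close>, so that it can be compared with
  members of \<open>counts X N\<close> by plain equality.\<close>

definition count_of :: "'a set \<Rightarrow> nat \<Rightarrow> (nat \<Rightarrow> 'a) \<Rightarrow> 'a \<Rightarrow> nat" where
  "count_of X N x = (\<lambda>z\<in>X. card {k \<in> {1..N}. x k = z})"

lemma count_of_in_counts:
  assumes "finite X" "x \<in> seqs X N"
  shows "count_of X N x \<in> counts X N"
proof -
  have "(\<Sum>z\<in>X. card {k \<in> {1..N}. x k = z}) = card (\<Union>z\<in>X. {k \<in> {1..N}. x k = z})"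
    using assms by (subst card_UN_disjoint) auto
  also have "(\<Union>z\<in>X. {k \<in> {1..N}. x k = z}) = {1..N}"
    using assms by (auto simp: seqs_def)
  finally show ?thesis
    by (simp add: counts_def count_of_def)
qed

lemma count_atom_eq:
  assumes "m \<in> counts X N"
  shows "count_atom X N m = {x \<in> seqs X N. count_of X N x = m}"
proof -
  have "(\<forall>z\<in>X. card {k \<in> {1..N}. x k = z} = m z) \<longleftrightarrow> count_of X N x = m" for x
  proof
    assume "\<forall>z\<in>X. card {k \<in> {1..N}. x k = z} = m z"
    then show "count_of X N x = m"
      using assms by (intro extensionalityI [of _ X]) (simp_all add: count_of_def counts_def)
  qed (auto simp: count_of_def)
  then show ?thesis
    by (simp add: count_atom_def)
qed

lemma finite_count_atom: "finite X \<Longrightarrow> finite (count_atom X N m)"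
  using finite_seqs [of X N] by (simp add: count_atom_def)

text \<open>Some symbol \<open>u\<close> has a positive count; a sequence with one \<open>u\<close>
  less exists by induction, and \<open>u\<close> is appended at the new last position. This makes
  the count atoms non-empty, so that \<open>Hy\<close> takes genuine means and never divides by
  0.\<close>

lemma ex_seq_with_counts:
  assumes "finite X" "(\<Sum>z\<in>X. m z) = N"
  shows "\<exists>x\<in>{1..N} \<rightarrow>\<^sub>E X. \<forall>z\<in>X. card {k \<in> {1..N}. x k = z} = (m z :: nat)"
  using assms(2)
proof (induction N arbitrary: m)
  case 0
  then show ?case using assms(1) by auto
next
  case (Suc N)
  then obtain u where u: "u \<in> X" "m u > 0"
    by (metis gr0I nat.distinct(1) sum.neutral)
  have "(\<Sum>z\<in>X. (m(u := m u - 1)) z) = N"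
    using Suc.prems u assms(1) by (simp add: sum.remove [of X u])
  from Suc.IH [OF this] obtain x where
    x: "x \<in> {1..N} \<rightarrow>\<^sub>E X" "\<And>z. z \<in> X \<Longrightarrow> card {k \<in> {1..N}. x k = z} = (m(u := m u - 1)) z"
    by blast
  let ?y = "x(Suc N := u)"
  have "?y \<in> {1..Suc N} \<rightarrow>\<^sub>E X"
    using x(1) u by (auto simp: PiE_iff extensional_def)
  moreover have "card {k \<in> {1..Suc N}. ?y k = z} = m z" if "z \<in> X" for z
  proof -
    have "{k \<in> {1..Suc N}. ?y k = z} =
        {k \<in> {1..N}. x k = z} \<union> (if z = u then {Suc N} else {})"
      by auto
    then show ?thesis
      using x(2) [OF that] u by (cases "z = u") auto
  qed
  ultimately show ?case by blast
qed

lemma card_count_atom_pos: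
  assumes "finite X" "m \<in> counts X N"
  shows "card (count_atom X N m) > 0"
proof -
  have "count_atom X N m \<noteq> {}"
    using ex_seq_with_counts [OF assms(1), of m N] assms(2)
    by (auto simp: count_atom_def seqs_def counts_def)
  then show ?thesis
    using finite_count_atom [OF assms(1)] by (simp add: card_gt_0_iff)
qed

section \<open>The count atoms are the permutation orbits\<close>

lemma comp_permutes_in_seqs_iff:
  assumes "\<pi> permutes {1..N}"
  shows "x \<circ> \<pi> \<in> seqs X N \<longleftrightarrow> x \<in> seqs X N"
proof -
  have *: "x \<circ> \<sigma> \<in> seqs X N" if "x \<in> seqs X N" "\<sigma> permutes {1..N}" for x :: "nat \<Rightarrow> 'a" and \<sigma>
    using that permutes_in_image [OF that(2)] permutes_not_in [OF that(2)]
    by (auto simp: seqs_def PiE_iff extensional_def)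
  have "x \<circ> \<pi> \<circ> inv \<pi> = x"
    using permutes_inv_o(1) [OF assms] by (simp add: o_assoc [symmetric])
  then show ?thesis
    using * [of x \<pi>] * [of "x \<circ> \<pi>" "inv \<pi>"] assms permutes_inv [OF assms] by auto
qed

text \<open>\<open>\<pi>\<close> maps the positions where \<open>x \<circ> \<pi>\<close> takes a
  value bijectively onto those where \<open>x\<close> takes it.\<close>

lemma count_of_comp_permutes:
  assumes "\<pi> permutes {1..N}"
  shows "count_of X N (x \<circ> \<pi>) = count_of X N x"
proof -
  have "card {k \<in> {1..N}. x (\<pi> k) = z} = card {k \<in> {1..N}. x k = z}" for z
  proof (rule bij_betw_same_card [of \<pi>], rule bij_betw_imageI)
    show "inj_on \<pi> {k \<in> {1..N}. x (\<pi> k) = z}"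
      using permutes_inj_on [OF assms] .
    have "k \<in> \<pi> ` {k \<in> {1..N}. x (\<pi> k) = z}" if "k \<in> {1..N}" "x k = z" for k
      using that permutes_inverses(1) [OF assms] permutes_in_image [OF permutes_inv [OF assms]]
      by (intro image_eqI [of _ _ "inv \<pi> k"]) auto
    then show "\<pi> ` {k \<in> {1..N}. x (\<pi> k) = z} = {k \<in> {1..N}. x k = z}"
      using permutes_in_image [OF assms] by auto
  qed
  then show ?thesis
    by (simp add: count_of_def)
qed

text \<open>Equal counts, together with the absence of symbols outside \<open>X\<close>, mean that
  both sequences have the same multiset of values, and two listings of one multiset differ by a
  permutation of the positions.\<close>

lemma count_of_eq_imp_permuted:
  assumes "x \<in> seqs X N" "y \<in> seqs X N" "count_of X N x = count_of X N y"
  obtains \<pi> where "\<pi> permutes {1..N}" "x = y \<circ> \<pi>"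
proof -
  have "card {k \<in> {1..N}. x k = z} = card {k \<in> {1..N}. y k = z}" for z
  proof (cases "z \<in> X")
    case True
    then show ?thesis
      using fun_cong [OF assms(3), of z] by (simp add: count_of_def)
  next
    case False
    then have "{k \<in> {1..N}. x k = z} = {}" "{k \<in> {1..N}. y k = z} = {}"
      using assms(1,2) by (auto simp: seqs_def)
    then show ?thesis by (simp only:)
  qed
  moreover have "count (image_mset f (mset_set {1..N})) z = card {k \<in> {1..N}. f k = z}"
    for f :: "nat \<Rightarrow> 'a" and z
    by (auto simp: count_image_mset' intro!: arg_cong [where f = card])
  ultimately have "image_mset x (mset_set {1..N}) = image_mset y (mset_set {1..N})"
    by (intro multiset_eqI) (simp only:)
  then obtain \<pi> where \<pi>: "\<pi> permutes {1..N}" "\<forall>k\<in>{1..N}. x k = y (\<pi> k)"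
    by (rule image_mset_eq_implies_permutes [OF finite_atLeastAtMost])
  have "x = y \<circ> \<pi>"
  proof
    fix k
    show "x k = (y \<circ> \<pi>) k"
      using \<pi>(2) permutes_not_in [OF \<pi>(1), of k] assms(1,2)
      by (cases "k \<in> {1..N}") (auto simp: seqs_def PiE_iff extensional_def)
  qed
  with \<pi>(1) show ?thesis by (rule that)
qed

subsection \<open>The hypergeometric map\<close>

lemma Hy_in_gambles: "finite X \<Longrightarrow> Hy X N f \<in> gambles (counts X N)"
  by (simp add: gambles_iff finite_counts Hy_def)

lemma Hy_add: "Hy X N (f + g) = Hy X N f + Hy X N g"
  by (auto simp: Hy_def fun_eq_iff sum.distrib add_divide_distrib)

lemma Hy_diff: "Hy X N (f - g) = Hy X N f - Hy X N g"
  by (auto simp: Hy_def fun_eq_iff sum_subtractf diff_divide_distrib)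

lemma Hy_scale: "Hy X N (\<lambda>x. c * f x) = (\<lambda>m. c * Hy X N f m)"
  by (auto simp: Hy_def fun_eq_iff sum_distrib_left)

text \<open>Composition with \<open>\<pi>\<close> permutes each count atom, so the atom sums are
  merely reordered.\<close>

lemma Hy_perm_lift:
  assumes "\<pi> permutes {1..N}"
  shows "Hy X N (perm_lift \<pi> f) = Hy X N f"
proof -
  have "(\<Sum>y\<in>count_atom X N m. f (y \<circ> \<pi>)) = (\<Sum>y\<in>count_atom X N m. f y)"
    if "m \<in> counts X N" for m
  proof (rule sum.reindex_bij_witness [of _ "\<lambda>y. y \<circ> inv \<pi>" "\<lambda>y. y \<circ> \<pi>"])
    have closed: "y \<circ> \<sigma> \<in> count_atom X N m"
      if "y \<in> count_atom X N m" "\<sigma> permutes {1..N}" for y \<sigma>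
      using that \<open>m \<in> counts X N\<close>
      by (simp add: count_atom_eq comp_permutes_in_seqs_iff count_of_comp_permutes)
    fix y assume y: "y \<in> count_atom X N m"
    show "y \<circ> \<pi> \<in> count_atom X N m" "y \<circ> inv \<pi> \<in> count_atom X N m"
      using closed [OF y] assms permutes_inv [OF assms] by blast+
    show "y \<circ> \<pi> \<circ> inv \<pi> = y" "y \<circ> inv \<pi> \<circ> \<pi> = y"
      unfolding comp_assoc permutes_inv_o [OF assms] by simp_all
  qed simp
  then show ?thesis
    by (auto simp: Hy_def perm_lift_def)
qed

text \<open>Nothing cancels in a mean of nonnegative values: a point where \<open>f\<close> is
  positive makes the mean over its own count atom positive.\<close>

lemma Hy_pos:
  assumes "finite X" "f \<in> gambles (seqs X N)" "f \<ge> 0" "f \<noteq> 0"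
  shows "Hy X N f \<ge> 0" "Hy X N f \<noteq> 0"
proof -
  have nn: "f y \<ge> 0" for y
    using assms(3) by (simp add: le_fun_def)
  then show "Hy X N f \<ge> 0"
    by (auto simp: Hy_def le_fun_def intro!: divide_nonneg_nonneg sum_nonneg)
  obtain x where x: "f x \<noteq> 0"
    using assms(4) by (auto simp: fun_eq_iff)
  then have xs: "x \<in> seqs X N"
    using assms(2) gambles_iff [OF finite_seqs [OF assms(1)]] by blast
  define m where "m = count_of X N x"
  have m: "m \<in> counts X N"
    unfolding m_def by (rule count_of_in_counts [OF assms(1) xs])
  have "(\<Sum>y\<in>count_atom X N m. f y) > 0"
  proof (rule sum_pos2)
    show "finite (count_atom X N m)"
      by (rule finite_count_atom [OF assms(1)])
    show "x \<in> count_atom X N m"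
      using xs by (simp add: count_atom_eq [OF m]) (simp add: m_def)
    show "f x > 0"
      using x nn [of x] by simp
  qed (rule nn)
  then have "Hy X N f m > 0"
    using m card_count_atom_pos [OF assms(1) m] by (simp add: Hy_def)
  then show "Hy X N f \<noteq> 0" by auto
qed

text \<open>The permutation-invariant gamble that is constant on each count atom; since the mean of
  a constant is that constant, it is a right inverse of \<open>Hy\<close>.\<close>

definition count_lift :: "'a set \<Rightarrow> nat \<Rightarrow> (('a \<Rightarrow> nat) \<Rightarrow> real) \<Rightarrow> (nat \<Rightarrow> 'a) \<Rightarrow> real" where
  "count_lift X N g = (\<lambda>x. if x \<in> seqs X N then g (count_of X N x) else 0)"

lemma count_lift_in_gambles: "finite X \<Longrightarrow> count_lift X N g \<in> gambles (seqs X N)"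
  by (simp add: gambles_iff finite_seqs count_lift_def)

lemma Hy_count_lift:
  assumes "finite X" "g \<in> gambles (counts X N)"
  shows "Hy X N (count_lift X N g) = g"
proof
  fix m
  show "Hy X N (count_lift X N g) m = g m"
  proof (cases "m \<in> counts X N")
    case True
    then have "(\<Sum>y\<in>count_atom X N m. count_lift X N g y) = (\<Sum>y\<in>count_atom X N m. g m)"
      by (intro sum.cong) (auto simp: count_atom_eq count_lift_def)
    then show ?thesis
      using True card_count_atom_pos [OF assms(1) True] by (simp add: Hy_def)
  next
    case False
    then show ?thesis
      using assms by (simp add: Hy_def gambles_iff finite_counts)
  qed
qed

subsection \<open>Exchangeability and the kernel of the hypergeometric map\<close>

text \<open>Exchangeability absorbs one difference at a time and does not put the differences
  themselves into \<open>R\<close>; so they are added to \<open>h\<close> successively.\<close>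

lemma exchangeable_add_sum:
  assumes "exchangeable X N R" "h \<in> R" "finite A"
    and "\<And>y. y \<in> A \<Longrightarrow>
      \<exists>f\<in>gambles (seqs X N). \<exists>\<pi>. \<pi> permutes {1..N} \<and> d y = f - perm_lift \<pi> f"
  shows "h + (\<Sum>y\<in>A. d y) \<in> R"
  using assms(3,4)
proof (induction A rule: finite_induct)
  case empty
  then show ?case using assms(2) by simp
next
  case (insert y A)
  then have "h + (\<Sum>y\<in>A. d y) \<in> R" by blast
  moreover obtain f \<pi> where "f \<in> gambles (seqs X N)" "\<pi> permutes {1..N}" "d y = f - perm_lift \<pi> f"
    using insert.prems by blast
  ultimately have "h + (\<Sum>y\<in>A. d y) + d y \<in> R"
    using assms(1) unfolding exchangeable_def by metis
  moreover have "h + (\<Sum>y\<in>insert y A. d y) = h + (\<Sum>y\<in>A. d y) + d y"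
    unfolding sum.insert [OF insert.hyps] by (simp only: add.commute add.left_commute)
  ultimately show ?case by (simp only:)
qed

text \<open>
  Pick a representative in every count atom. If all atom sums of \<open>f\<close> vanish, then \<open>f\<close> is the sum
  over \<open>y\<close> of \<open>f y\<close> times the difference of the indicators of \<open>y\<close> and of its representative,
  and each summand has the form \<open>g - perm_lift \<pi> g\<close>.
\<close>

lemma exchangeable_add_kernel:
  assumes "finite X" "exchangeable X N R" "h \<in> R"
    and "f \<in> gambles (seqs X N)" and "Hy X N f = 0"
  shows "h + f \<in> R"
proof -
  let ?S = "seqs X N"
  define rep where "rep m = (SOME x. x \<in> ?S \<and> count_of X N x = m)" for m
  have rep: "rep (count_of X N y) \<in> ?S" "count_of X N (rep (count_of X N y)) = count_of X N y"
    if "y \<in> ?S" for y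
    using someI [of "\<lambda>x. x \<in> ?S \<and> count_of X N x = count_of X N y" y] that by (auto simp: rep_def)
  define d where "d y x = (if x = y then f y else 0) -
    (if x = rep (count_of X N y) then f y else 0)" for y x
  have "\<exists>g\<in>gambles ?S. \<exists>\<pi>. \<pi> permutes {1..N} \<and> d y = g - perm_lift \<pi> g" if y: "y \<in> ?S" for y
  proof -
    obtain \<pi> where \<pi>: "\<pi> permutes {1..N}" "y = rep (count_of X N y) \<circ> \<pi>"
      using count_of_eq_imp_permuted [OF y rep(1) [OF y]] rep(2) [OF y] by metis
    \<comment> \<open>A multiple of the point mass at \<open>y\<close>. Since \<open>y\<close> is
      its representative composed with \<open>\<pi>\<close>, the permuted lift is the same multiple
      of the point mass at the representative.\<close>
    define g where "g x = (if x = y then f y else 0)" for x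
    have "x \<circ> \<pi> = y \<longleftrightarrow> x = rep (count_of X N y)" for x
      using \<pi>(2) permutes_inv_o(1) [OF \<pi>(1)] by (metis comp_assoc comp_id)
    then have "d y = g - perm_lift \<pi> g"
      by (auto simp: d_def g_def perm_lift_def fun_eq_iff)
    moreover have "g \<in> gambles ?S"
      using y by (auto simp: gambles_iff finite_seqs assms(1) g_def)
    ultimately show ?thesis using \<pi>(1) by blast
  qed
  then have "h + (\<Sum>y\<in>?S. d y) \<in> R"
    by (intro exchangeable_add_sum [OF assms(2,3) finite_seqs [OF assms(1)]])
  moreover have "(\<Sum>y\<in>?S. d y) = f"
  proof
    fix x
    have fin: "finite ?S" by (rule finite_seqs [OF assms(1)])
    have "(\<Sum>y\<in>?S. d y) x = (\<Sum>y\<in>?S. d y x)"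
      using fin by (induction rule: finite_induct) simp_all
    also have "\<dots> = (\<Sum>y\<in>?S. if x = y then f y else 0) -
        (\<Sum>y\<in>?S. if x = rep (count_of X N y) then f y else 0)"
      by (simp add: d_def sum_subtractf)
    also have "(\<Sum>y\<in>?S. if x = y then f y else 0) = f x"
      using fin assms(4) by (simp add: sum.delta' gambles_iff)
    \<comment> \<open>Only a representative \<open>x\<close> receives contributions here; it
      receives the whole atom sum of \<open>f\<close>, which vanishes because
      \<open>Hy X N f = 0\<close>.\<close>
    also have "(\<Sum>y\<in>?S. if x = rep (count_of X N y) then f y else 0) = 0"
    proof (cases "x \<in> ?S \<and> rep (count_of X N x) = x")
      case False
      then have "x \<noteq> rep (count_of X N y)" if "y \<in> ?S" for y
        using rep [OF that] by auto
      then show ?thesis by simp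
    next
      case True
      define m where "m = count_of X N x"
      have m: "m \<in> counts X N"
        unfolding m_def using True assms(1) by (blast intro: count_of_in_counts)
      have *: "x = rep (count_of X N y) \<longleftrightarrow> count_of X N y = m" if "y \<in> ?S" for y
        using rep [OF that] True m_def by metis
      have "(\<Sum>y\<in>?S. if x = rep (count_of X N y) then f y else 0) =
          (\<Sum>y\<in>?S. if count_of X N y = m then f y else 0)"
        using * by (intro sum.cong) auto
      also have "\<dots> = (\<Sum>y\<in>count_atom X N m. f y)"
        using fin by (simp add: count_atom_eq [OF m] sum.inter_filter)
      also have "\<dots> = 0"
        using fun_cong [OF assms(5), of m] m card_count_atom_pos [OF assms(1) m]
        by (simp add: Hy_def del: card_eq_0_iff card_gt_0_iff)
      finally show ?thesis .
    qed
    finally show "(\<Sum>y\<in>?S. d y) x = f x" by simp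
  qed
  ultimately show ?thesis by simp
qed

text \<open>An exchangeable set is a union of fibres of \<open>Hy\<close>: \<open>f - h\<close> lies
  in the kernel and may be added to \<open>h\<close>.\<close>

lemma exchangeable_Hy_eq:
  assumes "finite X" "exchangeable X N R" "R \<subseteq> gambles (seqs X N)" "h \<in> R"
    and "f \<in> gambles (seqs X N)" "Hy X N f = Hy X N h"
  shows "f \<in> R"
proof -
  have "f - h \<in> gambles (seqs X N)"
    using assms by (auto simp: gambles_iff finite_seqs)
  moreover have "Hy X N (f - h) = 0"
    using assms(6) by (simp add: Hy_diff)
  ultimately have "h + (f - h) \<in> R"
    by (rule exchangeable_add_kernel [OF assms(1,2,4)])
  then show ?thesis by simp
qed

subsection \<open>Bernstein polynomials form a basis\<close>

lemma CoMn_add: "CoMn X N (g + h) = CoMn X N g + CoMn X N h"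
  by (auto simp: CoMn_def fun_eq_iff sum.distrib algebra_simps)

lemma CoMn_diff: "CoMn X N (g - h) = CoMn X N g - CoMn X N h"
  by (auto simp: CoMn_def fun_eq_iff sum_subtractf algebra_simps)

lemma CoMn_scale: "CoMn X N (\<lambda>m. c * g m) = (\<lambda>\<theta>. c * CoMn X N g \<theta>)"
  by (auto simp: CoMn_def fun_eq_iff sum_distrib_left mult.assoc)

lemma CoMn_eq:
  "CoMn X N g \<theta> = (if \<theta> \<in> prob_simplex X
     then \<Sum>m\<in>counts X N. g m * real (card (count_atom X N m)) * (\<Prod>z\<in>X. \<theta> z ^ m z) else 0)"
  by (simp add: CoMn_def bernstein_def mult.assoc)

lemma CoMn_in_poly_space:
  assumes "finite X"
  shows "CoMn X N g \<in> poly_space X N"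
proof -
  let ?c = "\<lambda>m. if m \<in> counts X N then g m * real (card (count_atom X N m)) else 0"
  have "(\<Sum>m\<in>counts X N. g m * real (card (count_atom X N m)) * (\<Prod>z\<in>X. \<theta> z ^ m z)) =
      (\<Sum>\<alpha> | \<alpha> \<in> extensional X \<and> (\<Sum>z\<in>X. \<alpha> z) \<le> N. ?c \<alpha> * (\<Prod>z\<in>X. \<theta> z ^ \<alpha> z))" for \<theta>
    using finite_extensional_sum_le [OF assms, of N]
    by (intro sum.mono_neutral_cong_left) (auto simp: counts_def)
  then show ?thesis
    unfolding poly_space_def CoMn_eq [abs_def] by (intro CollectI exI [of _ ?c]) (simp only:)
qed

text \<open>A nonzero polynomial has finitely many roots. Testing positive arguments only suffices,
  and only such arguments arise when points of the simplex are rescaled.\<close>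

lemma univariate_coeffs_zero:
  fixes a :: "nat \<Rightarrow> real"
  assumes "\<And>t. t > 0 \<Longrightarrow> (\<Sum>k\<le>n. a k * t ^ k) = 0" "k \<le> n"
  shows "a k = 0"
proof (rule ccontr)
  assume "a k \<noteq> 0"
  then have "finite {t. (\<Sum>k\<le>n. a k * t ^ k) = 0}"
    using assms(2) polyfun_finite_roots [of a n] by blast
  then have "finite {0::real<..}"
    by (rule rev_finite_subset) (use assms(1) in auto)
  then show False
    by (simp add: infinite_Ioi)
qed

text \<open>
  The exponents are arbitrary functions that only have to be told apart by their values on \<open>X\<close>,
  so that splitting off one variable does not force a change of their domain.
\<close>

lemma multivariate_coeffs_zero:
  fixes c :: "('a \<Rightarrow> nat) \<Rightarrow> real"
  assumes "finite X" "finite A" "\<And>m m'. m \<in> A \<Longrightarrow> m' \<in> A \<Longrightarrow> \<forall>z\<in>X. m z = m' z \<Longrightarrow> m = m'"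
    and "\<And>\<theta>. (\<forall>z. \<theta> z > 0) \<Longrightarrow> (\<Sum>m\<in>A. c m * (\<Prod>z\<in>X. \<theta> z ^ m z)) = 0"
  shows "\<forall>m\<in>A. c m = 0"
  using assms
proof (induction X arbitrary: A rule: finite_induct)
  case empty
  show ?case
  proof
    fix m assume "m \<in> A"
    then have "A = {m}" using empty.prems(2) by auto
    then show "c m = 0" using empty.prems(3) [of "\<lambda>_. 1"] by simp
  qed
next
  case (insert x X)
  \<comment> \<open>A bound for the exponents of the split-off variable; the inserted 0 keeps
    \<open>Max\<close> meaningful when \<open>A\<close> is empty.\<close>
  define n where "n = Max (insert 0 ((\<lambda>m. m x) ` A))"
  have n: "m x \<le> n" if "m \<in> A" for m
    using that insert.prems(1) by (simp add: n_def)
  \<comment> \<open>With the other variables fixed, the whole sum is a polynomial in the value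
    \<open>t\<close> of the variable \<open>x\<close>, and these are its coefficients.\<close>
  have "(\<Sum>m | m \<in> A \<and> m x = k. c m * (\<Prod>z\<in>X. \<theta> z ^ m z)) = 0"
    if "k \<le> n" and \<theta>: "\<forall>z. \<theta> z > 0" for k \<theta>
  proof (rule univariate_coeffs_zero [OF _ \<open>k \<le> n\<close>])
    fix t :: real assume "t > 0"
    have upd: "(\<Prod>z\<in>X. (\<theta>(x := t)) z ^ m z) = (\<Prod>z\<in>X. \<theta> z ^ m z)" for m
      using insert.hyps by (intro prod.cong) auto
    have "0 = (\<Sum>m\<in>A. c m * (\<Prod>z\<in>insert x X. (\<theta>(x := t)) z ^ m z))"
      using \<theta> \<open>t > 0\<close> by (intro insert.prems(3) [symmetric]) auto
    also have "\<dots> = (\<Sum>m\<in>A. c m * (\<Prod>z\<in>X. \<theta> z ^ m z) * t ^ m x)"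
      using insert.hyps upd by (simp add: mult_ac)
    also have "\<dots> = (\<Sum>k\<le>n. \<Sum>m | m \<in> A \<and> m x = k. c m * (\<Prod>z\<in>X. \<theta> z ^ m z) * t ^ m x)"
      using insert.prems(1) n by (intro sum.group [symmetric]) auto
    also have "\<dots> = (\<Sum>k\<le>n. (\<Sum>m | m \<in> A \<and> m x = k. c m * (\<Prod>z\<in>X. \<theta> z ^ m z)) * t ^ k)"
      by (simp add: sum_distrib_right)
    finally show "(\<Sum>k\<le>n. (\<Sum>m | m \<in> A \<and> m x = k. c m * (\<Prod>z\<in>X. \<theta> z ^ m z)) * t ^ k) = 0"
      by simp
  qed
  \<comment> \<open>Exponents in one slice agree at \<open>x\<close>, so they are told apart on
    \<open>X\<close> alone and the induction hypothesis applies to the slice.\<close>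
  then have "\<forall>m\<in>{m \<in> A. m x = k}. c m = 0" if "k \<le> n" for k
    using that insert.prems(1,2) by (intro insert.IH) auto
  then show ?case using n by blast
qed

text \<open>Linear independence by homogeneity: all monomials involved have degree exactly
  \<open>N\<close>, so scaling a positive point \<open>\<theta>\<close> onto the simplex by its
  coordinate sum \<open>s\<close> changes the sum only by the factor \<open>s ^ N\<close>. A
  relation on the simplex thus extends to all positive points, where the coefficients must vanish;
  the atom sizes contained in them are nonzero and cancel.\<close>

lemma CoMn_eq_0_imp:
  assumes "finite X" "X \<noteq> {}" "g \<in> gambles (counts X N)" "CoMn X N g = 0"
  shows "g = 0"
proof
  fix m
  define c where "c m = g m * real (card (count_atom X N m))" for m
  have "(\<Sum>m\<in>counts X N. c m * (\<Prod>z\<in>X. \<theta> z ^ m z)) = 0" if \<theta>: "\<forall>z. \<theta> z > 0" for \<theta>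
  proof -
    define s where "s = (\<Sum>z\<in>X. \<theta> z)"
    have s: "s > 0"
      unfolding s_def using assms \<theta> by (intro sum_pos) auto
    define \<eta> where "\<eta> = (\<lambda>z\<in>X. \<theta> z / s)"
    have "(\<Sum>z\<in>X. \<theta> z / s) = 1"
      using s by (simp add: s_def sum_divide_distrib [symmetric])
    then have "\<eta> \<in> prob_simplex X"
      using \<theta> s by (auto simp: prob_simplex_def \<eta>_def less_imp_le)
    then have "(\<Sum>m\<in>counts X N. c m * (\<Prod>z\<in>X. \<eta> z ^ m z)) = 0"
      using fun_cong [OF assms(4), of \<eta>] by (simp add: CoMn_eq c_def)
    then have "0 = s ^ N * (\<Sum>m\<in>counts X N. c m * (\<Prod>z\<in>X. \<eta> z ^ m z))"
      by simp
    also have "\<dots> = (\<Sum>m\<in>counts X N. c m * (\<Prod>z\<in>X. \<theta> z ^ m z))"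
      unfolding sum_distrib_left
    proof (rule sum.cong [OF refl])
      fix m assume "m \<in> counts X N"
      then have "s ^ N = (\<Prod>z\<in>X. s ^ m z)"
        by (auto simp: counts_def power_sum)
      moreover have "(\<Prod>z\<in>X. s ^ m z) * (\<Prod>z\<in>X. \<eta> z ^ m z) = (\<Prod>z\<in>X. \<theta> z ^ m z)"
        unfolding prod.distrib [symmetric] using s
        by (intro prod.cong) (auto simp: \<eta>_def power_mult_distrib [symmetric])
      ultimately show "s ^ N * (c m * (\<Prod>z\<in>X. \<eta> z ^ m z)) = c m * (\<Prod>z\<in>X. \<theta> z ^ m z)"
        by (simp add: mult.left_commute)
    qed
    finally show ?thesis by simp
  qed
  then have "\<forall>m\<in>counts X N. c m = 0"
  proof (intro multivariate_coeffs_zero [OF assms(1) finite_counts [OF assms(1)]])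
    fix m m' assume "m \<in> counts X N" "m' \<in> counts X N" "\<forall>z\<in>X. m z = m' z"
    then show "m = m'"
      by (intro extensionalityI [of m X]) (simp_all add: counts_def)
  qed
  then show "g m = 0 m"
    using assms(3) card_count_atom_pos [OF assms(1), of m N]
    by (cases "m \<in> counts X N") (auto simp: c_def gambles_iff finite_counts [OF assms(1)])
qed

lemma CoMn_inj:
  assumes "finite X" "X \<noteq> {}" "g \<in> gambles (counts X N)" "h \<in> gambles (counts X N)"
    and "CoMn X N g = CoMn X N h"
  shows "g = h"
proof -
  have "g - h = 0"
    using assms by (intro CoMn_eq_0_imp [OF assms(1,2)])
      (auto simp: gambles_iff finite_counts CoMn_diff)
  then show ?thesis by simp
qed

text \<open>Injectivity of \<open>CoMn\<close> makes the definite description unique. This turns the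
  positivity condition of Bernstein coherence into a condition on gambles on counts.\<close>

lemma bernstein_coeffs_CoMn:
  assumes "finite X" "X \<noteq> {}" "g \<in> gambles (counts X N)"
  shows "bernstein_coeffs X N (CoMn X N g) = g"
proof -
  have "bernstein_coeffs X N p = (THE b. b \<in> gambles (counts X N) \<and> p = CoMn X N b)" for p
    by (simp only: bernstein_coeffs_def CoMn_def)
  then show ?thesis
    using assms(3) CoMn_inj [OF assms(1,2) _ assms(3)] by (simp only:) (rule the_equality; metis)
qed

section \<open>The Bernstein polynomials span the polynomial space\<close>

text \<open>
  The degree of a monomial can be raised to \<open>N\<close> by multiplying with powers of \<open>\<Sum>z\<in>X. \<theta> z = 1\<close>.
\<close>

lemma monomial_in_range_CoMn:
  assumes "finite X" "\<alpha> \<in> extensional X" "(\<Sum>z\<in>X. \<alpha> z) \<le> N"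
  shows "\<exists>g. \<forall>\<theta>\<in>prob_simplex X. CoMn X N g \<theta> = (\<Prod>z\<in>X. \<theta> z ^ \<alpha> z)"
  using assms(2,3)
\<comment> \<open>Induction on the missing degree; when none is missing, the monomial is a multiple
  of a single Bernstein polynomial.\<close>
proof (induction "N - (\<Sum>z\<in>X. \<alpha> z)" arbitrary: \<alpha>)
  case 0
  then have \<alpha>: "\<alpha> \<in> counts X N" by (simp add: counts_def)
  let ?g = "\<lambda>m. if m = \<alpha> then 1 / real (card (count_atom X N \<alpha>)) else 0"
  have "CoMn X N ?g \<theta> = (\<Prod>z\<in>X. \<theta> z ^ \<alpha> z)" if "\<theta> \<in> prob_simplex X" for \<theta>
    using that \<alpha> card_count_atom_pos [OF assms(1) \<alpha>] finite_counts [OF assms(1)]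
    by (simp add: CoMn_eq if_distrib [where f = "\<lambda>x. x * _"] cong: if_cong)
  then show ?case by blast
next
  case (Suc d)
  \<comment> \<open>The exponent of the monomial multiplied by \<open>\<theta> u\<close>. On the
    simplex, summing these products over \<open>u\<close> returns the original monomial.\<close>
  let ?up = "\<lambda>u. \<alpha>(u := Suc (\<alpha> u))"
  have "\<exists>g. \<forall>\<theta>\<in>prob_simplex X. CoMn X N g \<theta> = (\<Prod>z\<in>X. \<theta> z ^ ?up u z)" if "u \<in> X" for u
  proof (rule Suc.hyps(1))
    have "(\<Sum>z\<in>X. ?up u z) = Suc (\<Sum>z\<in>X. \<alpha> z)"
      using that assms(1) by (simp add: sum.remove [of X u])
    then show "d = N - (\<Sum>z\<in>X. ?up u z)" "(\<Sum>z\<in>X. ?up u z) \<le> N"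
      using Suc.hyps(2) by auto
    show "?up u \<in> extensional X"
      using that Suc.prems by (auto simp: extensional_def)
  qed
  then obtain G where G: "\<And>u \<theta>. u \<in> X \<Longrightarrow> \<theta> \<in> prob_simplex X \<Longrightarrow>
      CoMn X N (G u) \<theta> = (\<Prod>z\<in>X. \<theta> z ^ ?up u z)"
    by metis
  have "CoMn X N (\<lambda>m. \<Sum>u\<in>X. G u m) \<theta> = (\<Prod>z\<in>X. \<theta> z ^ \<alpha> z)" if "\<theta> \<in> prob_simplex X" for \<theta>
  proof -
    have "CoMn X N (\<lambda>m. \<Sum>u\<in>X. G u m) \<theta> = (\<Sum>u\<in>X. CoMn X N (G u) \<theta>)"
      unfolding CoMn_def sum_distrib_right by (rule sum.swap)
    also have "\<dots> = (\<Sum>u\<in>X. \<theta> u * (\<Prod>z\<in>X. \<theta> z ^ \<alpha> z))"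
      using assms(1) that by (intro sum.cong) (auto simp: G prod.remove)
    also have "\<dots> = (\<Prod>z\<in>X. \<theta> z ^ \<alpha> z)"
      using that by (simp add: sum_distrib_right [symmetric] prob_simplex_def)
    finally show ?thesis .
  qed
  then show ?case by blast
qed

lemma CoMn_surj:
  assumes "finite X" "p \<in> poly_space X N"
  obtains g where "g \<in> gambles (counts X N)" "p = CoMn X N g"
proof -
  let ?A = "{\<alpha> \<in> extensional X. (\<Sum>z\<in>X. \<alpha> z) \<le> N}"
  obtain c where c: "p = (\<lambda>\<theta>. if \<theta> \<in> prob_simplex X
      then (\<Sum>\<alpha>\<in>?A. c \<alpha> * (\<Prod>z\<in>X. \<theta> z ^ \<alpha> z)) else 0)"
    using assms(2) by (auto simp: poly_space_def)
  have "\<forall>\<alpha>\<in>?A. \<exists>g. \<forall>\<theta>\<in>prob_simplex X. CoMn X N g \<theta> = (\<Prod>z\<in>X. \<theta> z ^ \<alpha> z)"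
    using monomial_in_range_CoMn [OF assms(1)] by blast
  then obtain G where G: "\<forall>\<alpha>\<in>?A. \<forall>\<theta>\<in>prob_simplex X.
      CoMn X N (G \<alpha>) \<theta> = (\<Prod>z\<in>X. \<theta> z ^ \<alpha> z)"
    by (rule bchoice [THEN exE])
  \<comment> \<open>\<open>CoMn\<close> reads its argument only at counts; the value 0 elsewhere
    makes \<open>?g\<close> a gamble on \<open>counts X N\<close>.\<close>
  let ?g = "\<lambda>m. if m \<in> counts X N then \<Sum>\<alpha>\<in>?A. c \<alpha> * G \<alpha> m else 0"
  have "p \<theta> = CoMn X N ?g \<theta>" for \<theta>
  proof (cases "\<theta> \<in> prob_simplex X")
    case True
    have "CoMn X N ?g \<theta> = (\<Sum>m\<in>counts X N. \<Sum>\<alpha>\<in>?A. c \<alpha> * (G \<alpha> m * bernstein X N m \<theta>))"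
      by (simp add: CoMn_def sum_distrib_right mult.assoc)
    also have "\<dots> = (\<Sum>\<alpha>\<in>?A. c \<alpha> * CoMn X N (G \<alpha>) \<theta>)"
      by (subst sum.swap) (simp add: CoMn_def sum_distrib_left)
    also have "\<dots> = p \<theta>"
      using True G by (auto simp: c intro!: sum.cong)
    finally show ?thesis by simp
  qed (simp add: c CoMn_eq)
  moreover have "?g \<in> gambles (counts X N)"
    by (simp add: gambles_iff finite_counts assms(1))
  ultimately show ?thesis using that by blast
qed

subsection \<open>The representation theorem\<close>

lemma Mn_eq: "Mn X N f = CoMn X N (Hy X N f)"
  by (simp add: Mn_def)

lemma Mn_add: "Mn X N (f + g) = Mn X N f + Mn X N g"
  by (simp add: Mn_eq Hy_add CoMn_add)

lemma Mn_scale: "Mn X N (\<lambda>x. c * f x) = (\<lambda>\<theta>. c * Mn X N f \<theta>)"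
  by (simp add: Mn_eq Hy_scale CoMn_scale)

lemma Mn_surj:
  assumes "finite X" "p \<in> poly_space X N"
  obtains f where "f \<in> gambles (seqs X N)" "p = Mn X N f"
proof -
  obtain g where "g \<in> gambles (counts X N)" "p = CoMn X N g"
    using CoMn_surj [OF assms] .
  with that [of "count_lift X N g"] show ?thesis
    using assms(1) by (simp add: count_lift_in_gambles Mn_eq Hy_count_lift)
qed

text \<open>\<open>CoMn\<close> is injective on gambles, so the fibres of \<open>Mn\<close> are
  those of \<open>Hy\<close>.\<close>

lemma exchangeable_Mn_eq:
  assumes "finite X" "X \<noteq> {}" "exchangeable X N R" "R \<subseteq> gambles (seqs X N)" "h \<in> R"
    and "f \<in> gambles (seqs X N)" "Mn X N f = Mn X N h"
  shows "f \<in> R"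
proof (rule exchangeable_Hy_eq [OF assms(1,3,4,5,6)])
  show "Hy X N f = Hy X N h"
    using assms by (intro CoMn_inj [OF assms(1,2)]) (auto simp: Hy_in_gambles Mn_eq)
qed

text \<open>If 0 were in the image, its whole fibre, including the zero gamble, would lie in
  \<open>R\<close>. A polynomial with positive Bernstein coefficients is the image of the lift of
  these coefficients, which is a positive gamble and so lies in \<open>R\<close>. The cone
  conditions follow from linearity.\<close>

lemma bernstein_coherent_Mn_image:
  assumes "finite X" "X \<noteq> {}" "coherent (seqs X N) R" "exchangeable X N R"
  shows "bernstein_coherent X N (Mn X N ` R)"
  unfolding bernstein_coherent_def
proof (intro conjI ballI allI impI)
  have R: "R \<subseteq> gambles (seqs X N)"
    using assms(3) by (simp add: coherent_def)
  show "Mn X N ` R \<subseteq> poly_space X N"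
    using assms(1) by (auto simp: Mn_eq CoMn_in_poly_space)
  have "0 \<in> R" if "Mn X N f = 0" "f \<in> R" for f
  proof (rule exchangeable_Mn_eq [OF assms(1,2,4) R that(2)])
    show "0 \<in> gambles (seqs X N)"
      by (simp add: gambles_iff finite_seqs assms(1))
    have "Mn X N 0 = 0"
      by (auto simp: Mn_eq Hy_def CoMn_def fun_eq_iff)
    then show "Mn X N 0 = Mn X N f"
      using that(1) by simp
  qed
  then show "0 \<notin> Mn X N ` R"
    using assms(3) by (force simp: coherent_def)
  show "p \<in> Mn X N ` R"
    if p: "p \<in> poly_space X N" "bernstein_coeffs X N p \<ge> 0 \<and> bernstein_coeffs X N p \<noteq> 0" for p
  proof -
    obtain g where g: "g \<in> gambles (counts X N)" "p = CoMn X N g"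
      using CoMn_surj [OF assms(1) p(1)] .
    let ?f = "count_lift X N g"
    have pos: "g \<ge> 0" "g \<noteq> 0"
      using p(2) g by (auto simp: bernstein_coeffs_CoMn [OF assms(1,2)])
    have Hy: "Hy X N ?f = g"
      by (rule Hy_count_lift [OF assms(1) g(1)])
    have "?f \<ge> 0"
      using pos(1) by (auto simp: le_fun_def count_lift_def)
    moreover have "Hy X N 0 = 0"
      by (auto simp: Hy_def)
    then have "?f \<noteq> 0"
      using Hy pos(2) by metis
    ultimately have "?f \<in> R"
      using assms(3) count_lift_in_gambles [OF assms(1)] by (auto simp: coherent_def)
    then show ?thesis
      using Hy g(2) by (auto simp: Mn_eq intro!: image_eqI [of _ _ ?f])
  qed
  show "(\<lambda>\<theta>. c * p \<theta>) \<in> Mn X N ` R" if p: "p \<in> Mn X N ` R" and "c > 0" for p c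
  proof -
    obtain f where "f \<in> R" "p = Mn X N f" using p by blast
    then show ?thesis
      using assms(3) \<open>c > 0\<close>
      by (auto simp: coherent_def Mn_scale intro!: image_eqI [of _ _ "\<lambda>x. c * f x"])
  qed
  show "p + q \<in> Mn X N ` R" if pq: "p \<in> Mn X N ` R" "q \<in> Mn X N ` R" for p q
  proof -
    obtain f g where "f \<in> R" "p = Mn X N f" "g \<in> R" "q = Mn X N g" using pq by blast
    then show ?thesis
      using assms(3)
      by (auto simp: coherent_def Mn_add intro!: image_eqI [of _ _ "f + g"])
  qed
qed

text \<open>The Bernstein coefficients of \<open>Mn X N f\<close> are \<open>Hy X N f\<close>, which
  inherits positivity from \<open>f\<close>; the remaining conditions are linearity.\<close>

lemma coherent_vimage_Mn:
  assumes "finite X" "X \<noteq> {}" "bernstein_coherent X N H"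
  shows "coherent (seqs X N) (Mn X N -` H \<inter> gambles (seqs X N))"
  unfolding coherent_def
proof (intro conjI ballI allI impI)
  have "Mn X N 0 = 0"
    by (auto simp: Mn_eq Hy_def CoMn_def fun_eq_iff)
  then show "0 \<notin> Mn X N -` H \<inter> gambles (seqs X N)"
    using assms(3) by (auto simp: bernstein_coherent_def)
  show "f \<in> Mn X N -` H \<inter> gambles (seqs X N)"
    if f: "f \<in> gambles (seqs X N)" "f \<ge> 0 \<and> f \<noteq> 0" for f
  proof -
    have "Hy X N f \<ge> 0" "Hy X N f \<noteq> 0"
      using Hy_pos [OF assms(1) f(1)] f(2) by auto
    then have "Mn X N f \<in> H"
      using assms by (auto simp: bernstein_coherent_def Mn_eq CoMn_in_poly_space
          bernstein_coeffs_CoMn Hy_in_gambles)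
    with f(1) show ?thesis by simp
  qed
qed (use assms finite_seqs [OF assms(1)] in \<open>auto simp: bernstein_coherent_def Mn_scale Mn_add
      intro: gambles_scale gambles_add\<close>)

text \<open>Adding \<open>f - perm_lift \<pi> f\<close> does not change the value of
  \<open>Mn\<close>.\<close>

lemma exchangeable_vimage_Mn:
  assumes "finite X"
  shows "exchangeable X N (Mn X N -` H \<inter> gambles (seqs X N))"
  unfolding exchangeable_def
proof (intro ballI allI impI)
  fix h f :: "(nat \<Rightarrow> 'a) \<Rightarrow> real" and \<pi>
  assume *: "h \<in> Mn X N -` H \<inter> gambles (seqs X N)" "f \<in> gambles (seqs X N)" "\<pi> permutes {1..N}"
  then have "h + (f - perm_lift \<pi> f) \<in> gambles (seqs X N)"
    using finite_seqs [OF assms, of N]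
    by (auto simp: gambles_iff perm_lift_def comp_permutes_in_seqs_iff)
  moreover have "Mn X N (h + (f - perm_lift \<pi> f)) = Mn X N h"
    using *(3) by (simp add: Mn_eq Hy_add Hy_diff Hy_perm_lift)
  ultimately show "h + (f - perm_lift \<pi> f) \<in> Mn X N -` H \<inter> gambles (seqs X N)"
    using *(1) by simp
qed

text \<open>Lifts supply the \<open>Hy\<close>-preimages for the direction from \<open>R\<close> to
  its count representation. In the other direction, \<open>Mn X N f \<in> H\<close> only shows that
  \<open>f\<close> shares its \<open>Hy\<close>-value with some member of \<open>R\<close>;
  exchangeability then brings \<open>f\<close> itself into \<open>R\<close>.\<close>

lemma Mn_vimage_iff_CoMn_vimage:
  assumes "finite X" "R \<subseteq> gambles (seqs X N)" "exchangeable X N R"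
  shows "R = Mn X N -` H \<inter> gambles (seqs X N) \<longleftrightarrow>
    Hy X N ` R = CoMn X N -` H \<inter> gambles (counts X N)"
proof
  assume R: "R = Mn X N -` H \<inter> gambles (seqs X N)"
  show "Hy X N ` R = CoMn X N -` H \<inter> gambles (counts X N)"
  proof (intro subset_antisym subsetI)
    fix g assume "g \<in> Hy X N ` R"
    then show "g \<in> CoMn X N -` H \<inter> gambles (counts X N)"
      using assms(1) by (auto simp: R Mn_eq Hy_in_gambles)
  next
    fix g assume g: "g \<in> CoMn X N -` H \<inter> gambles (counts X N)"
    then have "Hy X N (count_lift X N g) = g"
      by (simp add: Hy_count_lift assms(1))
    moreover from this have "count_lift X N g \<in> R"
      using g by (simp add: R Mn_eq count_lift_in_gambles assms(1))
    ultimately show "g \<in> Hy X N ` R" by (metis imageI)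
  qed
next
  assume S: "Hy X N ` R = CoMn X N -` H \<inter> gambles (counts X N)"
  show "R = Mn X N -` H \<inter> gambles (seqs X N)"
  proof (intro subset_antisym subsetI)
    fix f assume "f \<in> R"
    then show "f \<in> Mn X N -` H \<inter> gambles (seqs X N)"
      using S assms(2) by (auto simp: Mn_eq)
  next
    fix f assume f: "f \<in> Mn X N -` H \<inter> gambles (seqs X N)"
    then have "Hy X N f \<in> Hy X N ` R"
      using S by (simp add: Mn_eq Hy_in_gambles assms(1))
    then show "f \<in> R"
      using exchangeable_Hy_eq [OF assms(1,3,2)] f by auto
  qed
qed

lemma Mn_image_eq: "Mn X N ` R = CoMn X N ` Hy X N ` R"
  by (simp add: Mn_def image_comp)

text \<open>Inverse images are cut down to gambles because the maps act on the full function types.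
  The two equations are compared for exchangeable \<open>R\<close>, since \<open>S\<close> in
  general determines \<open>R\<close> only up to fibres of \<open>Hy\<close>. Uniqueness is drawn
  from either equation, as both \<open>Mn\<close> and \<open>CoMn\<close> are onto
  \<open>poly_space X N\<close>.\<close>

theorem theorem21:
  fixes X :: "'a set" and N :: nat
    and R :: "((nat \<Rightarrow> 'a) \<Rightarrow> real) set"
    and S :: "(('a \<Rightarrow> nat) \<Rightarrow> real) set"
  assumes "finite X" and "X \<noteq> {}" and "N \<ge> 1"
    and "R \<subseteq> gambles (seqs X N)"
    and "S = Hy X N ` R"
  shows "(coherent (seqs X N) R \<and> exchangeable X N R \<longleftrightarrow>
            (\<exists>H. bernstein_coherent X N H \<and> R = Mn X N -` H \<inter> gambles (seqs X N))) \<and>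
         (exchangeable X N R \<longrightarrow>
            (\<forall>H. bernstein_coherent X N H \<longrightarrow>
               (R = Mn X N -` H \<inter> gambles (seqs X N) \<longleftrightarrow>
                S = CoMn X N -` H \<inter> gambles (counts X N)))) \<and>
         (\<forall>H. bernstein_coherent X N H \<and>
               (R = Mn X N -` H \<inter> gambles (seqs X N) \<or>
                S = CoMn X N -` H \<inter> gambles (counts X N)) \<longrightarrow>
               H = Mn X N ` R \<and> H = CoMn X N ` S)"
proof (intro conjI)
  show "coherent (seqs X N) R \<and> exchangeable X N R \<longleftrightarrow>
      (\<exists>H. bernstein_coherent X N H \<and> R = Mn X N -` H \<inter> gambles (seqs X N))"
  proof
    assume R: "coherent (seqs X N) R \<and> exchangeable X N R"
    \<comment> \<open>The witness for \<open>H\<close> is the image of \<open>R\<close>; this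
      equation says that \<open>R\<close> is a union of fibres.\<close>
    then have "R = Mn X N -` (Mn X N ` R) \<inter> gambles (seqs X N)"
      using assms(4) exchangeable_Mn_eq [OF assms(1,2) _ assms(4)] by blast
    then show "\<exists>H. bernstein_coherent X N H \<and> R = Mn X N -` H \<inter> gambles (seqs X N)"
      using bernstein_coherent_Mn_image [OF assms(1,2)] R by blast
  next
    assume "\<exists>H. bernstein_coherent X N H \<and> R = Mn X N -` H \<inter> gambles (seqs X N)"
    then obtain H where "bernstein_coherent X N H" "R = Mn X N -` H \<inter> gambles (seqs X N)"
      by blast
    then show "coherent (seqs X N) R \<and> exchangeable X N R"
      using coherent_vimage_Mn [OF assms(1,2)] exchangeable_vimage_Mn [OF assms(1)] by simp
  qed
  show "exchangeable X N R \<longrightarrow> (\<forall>H. bernstein_coherent X N H \<longrightarrow>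
      (R = Mn X N -` H \<inter> gambles (seqs X N) \<longleftrightarrow>
       S = CoMn X N -` H \<inter> gambles (counts X N)))"
    unfolding assms(5) by (intro impI allI Mn_vimage_iff_CoMn_vimage [OF assms(1,4)])
  show "\<forall>H. bernstein_coherent X N H \<and>
      (R = Mn X N -` H \<inter> gambles (seqs X N) \<or> S = CoMn X N -` H \<inter> gambles (counts X N)) \<longrightarrow>
      H = Mn X N ` R \<and> H = CoMn X N ` S"
  proof (intro allI impI, elim conjE)
    fix H
    assume "bernstein_coherent X N H" and
      RS: "R = Mn X N -` H \<inter> gambles (seqs X N) \<or> S = CoMn X N -` H \<inter> gambles (counts X N)"
    then have H: "H \<subseteq> poly_space X N"
      by (simp add: bernstein_coherent_def)
    from RS have "H = CoMn X N ` S"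
    proof
      assume R: "R = Mn X N -` H \<inter> gambles (seqs X N)"
      \<comment> \<open>Surjectivity: every member of \<open>H\<close> has a preimage among the
        gambles, and that preimage lies in \<open>R\<close>.\<close>
      have "p \<in> Mn X N ` R" if "p \<in> H" for p
      proof -
        have "p \<in> poly_space X N" using that H by blast
        then obtain f where "f \<in> gambles (seqs X N)" "p = Mn X N f"
          by (rule Mn_surj [OF assms(1)])
        then show ?thesis using that R by simp
      qed
      then have "H = Mn X N ` R" using R by auto
      then show ?thesis
        by (simp add: assms(5) Mn_image_eq)
    next
      assume S: "S = CoMn X N -` H \<inter> gambles (counts X N)"
      have "p \<in> CoMn X N ` S" if "p \<in> H" for p
      proof -
        have "p \<in> poly_space X N" using that H by blast
        then obtain g where "g \<in> gambles (counts X N)" "p = CoMn X N g"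
          by (rule CoMn_surj [OF assms(1)])
        then show ?thesis using that S by simp
      qed
      then show ?thesis using S by auto
    qed
    then show "H = Mn X N ` R \<and> H = CoMn X N ` S"
      by (simp add: assms(5) Mn_image_eq)
  qed
qed

end
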